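(* Let $P\subset\mathbb{R}^d$ be a rational polytope and fix a nonzero direction $c\in\mathbb{Z}^d$. Then the function $n\mapsto \mathrm{aw}_c(nP)$, for $n\in\mathbb{Z}_{\geq 0}$, is eventually quasilinear.
   Context: A rational polytope is the convex hull of finitely many points of $\mathbb{Q}^d$. For a convex body $K$ and nonzero $c\in\mathbb{Z}^d$, let $h_c(K)$ be the set of hyperplanes $H$ with normal vector $c$ such that $H\cap K\cap\mathbb{Z}^d\neq\emptyset$; the arithmetic width of $K$ in direction $c$ is $\mathrm{aw}_c(K)=|h_c(K)|$, which equals the number of distinct values of $c^Tx$ for $x\in K\cap\mathbb{Z}^d$. A function $f:\mathbb{Z}_{\geq0}\to\mathbb{Z}$ is eventually quasilinear if there exist a positive integer $p$, an integer $N$, and rational numbers $a_0,\dots,a_{p-1},b_0,\dots,b_{p-1}$ such that $f(n)=a_in+b_i$ whenever $n\geq N$ and $n\equiv i \pmod p$. *)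

theory Defs
  imports "HOL-Analysis.Analysis" "HOL-Number_Theory.Cong"
begin

definition rational_polytope :: "(real ^ 'd) set \<Rightarrow> bool" where
  "rational_polytope P \<longleftrightarrow>
     (\<exists>V. finite V \<and> (\<forall>v\<in>V. \<forall>i. v $ i \<in> \<rat>) \<and> P = convex hull V)"

definition integer_points :: "(real ^ 'd) set" where
  "integer_points = {x. \<forall>i. x $ i \<in> \<int>}"

definition real_vec :: "int ^ 'd \<Rightarrow> real ^ 'd" where
  "real_vec c = (\<chi> i. of_int (c $ i))"

definition lattice_hyperplanes :: "int ^ 'd \<Rightarrow> (real ^ 'd) set \<Rightarrow> (real ^ 'd) set set" where
  "lattice_hyperplanes c K =
     {H. (\<exists>t. H = {x. real_vec c \<bullet> x = t}) \<and> H \<inter> K \<inter> integer_points \<noteq> {}}"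

text \<open>For bounded \<open>K\<close> only finitely many hyperplanes qualify, so \<open>card\<close> is the
  true cardinality there.\<close>

definition arithmetic_width :: "int ^ 'd \<Rightarrow> (real ^ 'd) set \<Rightarrow> nat" where
  "arithmetic_width c K = card (lattice_hyperplanes c K)"

definition eventually_quasilinear :: "(nat \<Rightarrow> int) \<Rightarrow> bool" where
  "eventually_quasilinear f \<longleftrightarrow>
     (\<exists>(p::nat) (N::int) (a::nat \<Rightarrow> rat) (b::nat \<Rightarrow> rat). p > 0 \<and>
        (\<forall>(n::nat) i. int n \<ge> N \<longrightarrow> i < p \<longrightarrow> [n = i] (mod p) \<longrightarrow>
           of_int (f n) = a i * of_nat n + b i))"

end

theory Submission
  imports Defs
begin

text \<open>Let \<open>T n\<close> be the set of values of \<open>c\<close> on the lattice points of \<open>nP\<close>, let \<open>D\<close> clear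
  the denominators of the vertices of \<open>P\<close>, and let \<open>A\<close> and \<open>B\<close> be the minimum and the maximum
  of \<open>c\<close> on \<open>DP\<close>, attained at lattice points. Then \<open>T n + {A, B} \<subseteq> T (n + D)\<close>, and
  \<open>T n\<close> lies between \<open>An/D\<close> and \<open>Bn/D\<close>. Put \<open>X m = T (r + mD) - mA\<close> and \<open>b = B - A\<close>. In each
  residue class modulo \<open>b > 0\<close> that \<open>X m\<close> meets, the number of elements grows by at least one when
  \<open>m\<close> grows by one, and it is at most \<open>m\<close> plus a constant. So it minus \<open>m\<close> is eventually
  nondecreasing and bounded, hence eventually constant. If \<open>b = 0\<close>, then \<open>card (X m)\<close>
  itself is nondecreasing and bounded.\<close>

section \<open>Eventually linear integer sequences\<close>

definition eventually_linear :: "(nat \<Rightarrow> int) \<Rightarrow> bool" where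
  "eventually_linear f \<longleftrightarrow> (\<exists>a b M. \<forall>m\<ge>M. f m = a * int m + b)"

text \<open>The natural number \<open>nat (K - f m)\<close> has a least value over
  \<open>m \<ge> M\<close>, attained at some \<open>m0\<close>; monotonicity then leaves no room for
  \<open>f\<close> to change after \<open>m0\<close>.\<close>

lemma eventually_const_if_mono_bounded:
  fixes f :: "nat \<Rightarrow> int"
  assumes mono: "\<And>m. m \<ge> M \<Longrightarrow> f m \<le> f (Suc m)" and bound: "\<And>m. m \<ge> M \<Longrightarrow> f m \<le> K"
  shows "\<exists>c M'. \<forall>m\<ge>M'. f m = c"
proof -
  obtain m0 where m0: "m0 \<ge> M" and least: "\<And>m. m \<ge> M \<Longrightarrow> nat (K - f m0) \<le> nat (K - f m)"
    using ex_has_least_nat[of "\<lambda>m. m \<ge> M" M "\<lambda>m. nat (K - f m)"] by auto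
  have "f m = f m0" if "m \<ge> m0" for m
  proof -
    have "f m0 \<le> f m"
      using that by (induction m rule: dec_induct) (use mono m0 in \<open>auto intro: order_trans\<close>)
    moreover have "f m \<le> f m0"
      using least[of m] bound[of m] bound[of m0] m0 that by linarith
    ultimately show ?thesis by simp
  qed
  then show ?thesis by blast
qed

lemma eventually_linear_sum:
  assumes "finite I" and "\<And>i. i \<in> I \<Longrightarrow> eventually_linear (f i)"
  shows "eventually_linear (\<lambda>m. \<Sum>i\<in>I. f i m)"
  using assms
proof (induction I rule: finite_induct)
  case empty
  have "\<forall>m\<ge>0. (0::int) = 0 * int m + 0" by simp
  then show ?case unfolding eventually_linear_def by (metis sum.empty)
next
  case (insert i I)
  from insert.prems obtain a b M where 1: "\<And>m. m \<ge> M \<Longrightarrow> f i m = a * int m + b"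
    unfolding eventually_linear_def by blast
  from insert obtain a' b' M' where 2: "\<And>m. m \<ge> M' \<Longrightarrow> (\<Sum>i\<in>I. f i m) = a' * int m + b'"
    unfolding eventually_linear_def by blast
  have "\<forall>m\<ge>max M M'. (\<Sum>i\<in>insert i I. f i m) = (a + a') * int m + (b + b')"
    using 1 2 insert.hyps by (simp add: algebra_simps)
  then show ?case unfolding eventually_linear_def by blast
qed

text \<open>If some \<open>Y m\<close> is nonempty, the slope is exactly 1: the maximum shifted by
  \<open>b\<close> is always new, while elements of one class are at least \<open>b\<close> apart in
  an interval that lengthens by \<open>b\<close> per step.\<close>

lemma eventually_linear_card_residue_class:
  fixes Y :: "nat \<Rightarrow> int set"
  assumes b: "b > 0"
    and sub: "\<And>m. Y m \<subseteq> Y (Suc m)"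
    and shift: "\<And>m x. x \<in> Y m \<Longrightarrow> x + b \<in> Y (Suc m)"
    and bounds: "\<And>m. Y m \<subseteq> {l..h + int m * b}"
    and residue: "\<And>m x. x \<in> Y m \<Longrightarrow> x mod b = \<rho>"
  shows "eventually_linear (\<lambda>m. int (card (Y m)))"
proof (cases "\<forall>m. Y m = {}")
  case True
  then have "\<forall>m\<ge>0. int (card (Y m)) = 0 * int m + 0" by simp
  then show ?thesis unfolding eventually_linear_def by blast
next
  case False
  then obtain M where M: "Y M \<noteq> {}" by blast
  have fin: "finite (Y m)" for m
    using bounds finite_subset by blast
  have nonempty: "Y m \<noteq> {}" if "m \<ge> M" for m
    using that by (induction m rule: dec_induct) (use M sub in auto)
  have grow: "int (card (Y m)) - int m \<le> int (card (Y (Suc m))) - int (Suc m)" if "m \<ge> M" for m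
  proof -
    let ?z = "Max (Y m) + b"
    have "?z \<notin> Y m"
      using b fin[of m] Max_ge[of "Y m" ?z] by auto
    moreover have "insert ?z (Y m) \<subseteq> Y (Suc m)"
      using sub shift nonempty[OF that] fin by (simp add: subset_iff)
    ultimately have "Suc (card (Y m)) \<le> card (Y (Suc m))"
      using card_mono[OF fin] fin by (metis card_insert_disjoint)
    then show ?thesis by linarith
  qed
  \<comment> \<open>The quotients by \<open>b\<close> determine the elements of one class. The
    absolute values keep the bound valid when the interval of quotients is empty.\<close>
  have upper: "int (card (Y m)) - int m \<le> \<bar>h div b\<bar> + \<bar>l div b\<bar> + 1" for m
  proof -
    have inj: "inj_on (\<lambda>x. x div b) (Y m)"
      by (rule inj_onI) (metis residue div_mult_mod_eq)
    have "(\<lambda>x. x div b) ` Y m \<subseteq> {l div b..h div b + int m}"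
    proof (rule image_subsetI)
      fix x assume "x \<in> Y m"
      then have "l \<le> x" "x \<le> h + int m * b" using bounds[of m] by auto
      then have "l div b \<le> x div b" "x div b \<le> (h + int m * b) div b"
        using b by (blast intro: zdiv_mono1)+
      then show "x div b \<in> {l div b..h div b + int m}" using b by simp
    qed
    then have "card (Y m) \<le> card {l div b..h div b + int m}"
      using card_mono card_image[OF inj] by (metis finite_atLeastAtMost_int)
    then show ?thesis by simp
  qed
  obtain c M' where "\<forall>m\<ge>M'. int (card (Y m)) - int m = c"
    using eventually_const_if_mono_bounded[of M "\<lambda>m. int (card (Y m)) - int m"] grow upper
    by blast
  then have "\<forall>m\<ge>M'. int (card (Y m)) = 1 * int m + c" by (simp add: algebra_simps)
  then show ?thesis unfolding eventually_linear_def by blast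
qed

text \<open>Adding \<open>b\<close> preserves residues modulo \<open>b\<close>, so each class
  inherits the hypotheses and the counts add up. For \<open>b = 0\<close> the bounds do not depend
  on \<open>m\<close>.\<close>

lemma eventually_linear_card:
  fixes X :: "nat \<Rightarrow> int set"
  assumes b: "b \<ge> 0"
    and sub: "\<And>m. X m \<subseteq> X (Suc m)"
    and shift: "\<And>m x. x \<in> X m \<Longrightarrow> x + b \<in> X (Suc m)"
    and bounds: "\<And>m. X m \<subseteq> {l..h + int m * b}"
  shows "eventually_linear (\<lambda>m. int (card (X m)))"
proof (cases "b = 0")
  case True
  have "int (card (X m)) \<le> int (card (X (Suc m)))" for m
    using bounds[of "Suc m"] sub by (simp add: card_mono finite_subset)
  moreover have "int (card (X m)) \<le> int (card {l..h})" for m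
    using bounds[of m] True by (simp add: card_mono del: card_atLeastAtMost_int)
  ultimately obtain c M' where "\<forall>m\<ge>M'. int (card (X m)) = c"
    using eventually_const_if_mono_bounded[of 0 "\<lambda>m. int (card (X m))"] by blast
  then have "\<forall>m\<ge>M'. int (card (X m)) = 0 * int m + c" by simp
  then show ?thesis unfolding eventually_linear_def by blast
next
  case False
  with b have b: "b > 0" by simp
  define Y where "Y \<rho> m = {x \<in> X m. x mod b = \<rho>}" for \<rho> m
  have lin: "eventually_linear (\<lambda>m. int (card (Y \<rho> m)))" for \<rho>
    by (rule eventually_linear_card_residue_class[OF b, where l = l and h = h])
      (use sub shift bounds in \<open>auto simp: Y_def subset_iff\<close>)
  have "int (card (X m)) = (\<Sum>\<rho>\<in>{0..<b}. int (card (Y \<rho> m)))" for m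
  proof -
    have fin: "finite (X m)" using bounds finite_subset by blast
    have "X m = (\<Union>\<rho>\<in>{0..<b}. Y \<rho> m)" using b by (auto simp: Y_def)
    moreover have "card (\<Union>\<rho>\<in>{0..<b}. Y \<rho> m) = (\<Sum>\<rho>\<in>{0..<b}. card (Y \<rho> m))"
      by (rule card_UN_disjoint) (use fin in \<open>auto simp: Y_def\<close>)
    ultimately show ?thesis by simp
  qed
  then show ?thesis using eventually_linear_sum[of "{0..<b}"] lin by simp
qed

section \<open>From arithmetic progressions to quasilinearity\<close>

lemma eventually_quasilinear_if_eventually_linear:
  assumes D: "D > 0" and lin: "\<And>r. r < D \<Longrightarrow> eventually_linear (\<lambda>m. f (r + m * D))"
  shows "eventually_quasilinear f"
proof -
  from lin obtain a b M where
    lin: "\<And>r m. r < D \<Longrightarrow> m \<ge> M r \<Longrightarrow> f (r + m * D) = a r * int m + b r"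
    unfolding eventually_linear_def by metis
  \<comment> \<open>The sum bounds all thresholds \<open>M r\<close> at once; the factor
    \<open>D\<close> below turns the bound on \<open>n\<close> into one on
    \<open>n div D\<close>.\<close>
  define N where "N = (\<Sum>r<D. M r)"
  \<comment> \<open>The coefficients come from substituting \<open>m = (n - i) / D\<close> into
    \<open>a i * m + b i\<close>.\<close>
  have "rat_of_int (f n) = (of_int (a i) / of_nat D) * of_nat n +
      (of_int (b i) - of_int (a i) * of_nat i / of_nat D)"
    if "int n \<ge> int (N * D)" "i < D" "[n = i] (mod D)" for n i
  proof -
    define m where "m = n div D"
    have n: "n = i + m * D"
      using that div_mult_mod_eq[of n D] by (simp add: cong_def m_def)
    have "M i \<le> N"
      unfolding N_def using that by (intro member_le_sum) auto
    also have "N \<le> m"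
      unfolding m_def using that D by (simp add: less_eq_div_iff_mult_less_eq flip: of_nat_mult)
    finally have "f n = a i * int m + b i"
      using lin that n by blast
    then have "rat_of_int (f n) = of_int (a i) * of_nat m + of_int (b i)" by simp
    then show ?thesis using D by (simp add: n field_simps)
  qed
  then have "D > 0 \<and> (\<forall>n i. int n \<ge> int (N * D) \<longrightarrow> i < D \<longrightarrow> [n = i] (mod D) \<longrightarrow>
      rat_of_int (f n) = (\<lambda>i. of_int (a i) / of_nat D) i * of_nat n +
        (\<lambda>i. of_int (b i) - of_int (a i) * of_nat i / of_nat D) i)"
    using D by simp
  then show ?thesis
    unfolding eventually_quasilinear_def by (intro exI)
qed

text \<open>Along \<open>n = r + m * D\<close>, subtracting \<open>m * A\<close> makes the lower
  bound independent of \<open>m\<close>, turns \<open>addA\<close> into an inclusion and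
  \<open>addB\<close> into a shift by \<open>B - A\<close>.\<close>

lemma eventually_quasilinear_card:
  fixes T :: "nat \<Rightarrow> int set"
  assumes D: "D > 0" and AB: "A \<le> B"
    and lower: "\<And>n t. t \<in> T n \<Longrightarrow> int n * A \<le> int D * t"
    and upper: "\<And>n t. t \<in> T n \<Longrightarrow> int D * t \<le> int n * B"
    and addA: "\<And>n t. t \<in> T n \<Longrightarrow> t + A \<in> T (n + D)"
    and addB: "\<And>n t. t \<in> T n \<Longrightarrow> t + B \<in> T (n + D)"
  shows "eventually_quasilinear (\<lambda>n. int (card (T n)))"
proof (rule eventually_quasilinear_if_eventually_linear[OF D])
  fix r assume "r < D"
  define X where "X m = (\<lambda>t. t - int m * A) ` T (r + m * D)" for m
  have X_iff: "x \<in> X m \<longleftrightarrow> x + int m * A \<in> T (r + m * D)" for x m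
    unfolding X_def by (auto simp: image_iff) (metis add_diff_cancel_right')
  have "eventually_linear (\<lambda>m. int (card (X m)))"
  proof (rule eventually_linear_card)
    show "B - A \<ge> 0" using AB by simp
    show "X m \<subseteq> X (Suc m)" for m
      using addA[of _ "r + m * D"] by (force simp: X_iff algebra_simps)
    show "x + (B - A) \<in> X (Suc m)" if "x \<in> X m" for x m
      using addB[of "x + int m * A" "r + m * D"] that by (simp add: X_iff algebra_simps)
    show "X m \<subseteq> {-\<bar>int r * A\<bar>..\<bar>int r * B\<bar> + int m * (B - A)}" for m
    proof
      \<comment> \<open>Drops the factor \<open>D \<ge> 1\<close> without division: a positive
        \<open>x\<close> is at most \<open>D * x\<close>, and other \<open>x\<close> are at most the
        absolute value.\<close>
      have scale: "x \<le> \<bar>y\<bar>" if "int D * x \<le> y" for x y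
      proof (rule ccontr)
        assume "\<not> x \<le> \<bar>y\<bar>"
        then have "1 * x \<le> int D * x" using D by (intro mult_right_mono) auto
        with that \<open>\<not> x \<le> \<bar>y\<bar>\<close> show False by linarith
      qed
      fix x assume "x \<in> X m"
      then have x: "x + int m * A \<in> T (r + m * D)" by (simp add: X_iff)
      have "- x \<le> \<bar>- (int r * A)\<bar>"
        by (rule scale) (use lower[OF x] in \<open>simp add: algebra_simps\<close>)
      moreover have "x - int m * (B - A) \<le> \<bar>int r * B\<bar>"
        by (rule scale) (use upper[OF x] in \<open>simp add: algebra_simps\<close>)
      ultimately show "x \<in> {-\<bar>int r * A\<bar>..\<bar>int r * B\<bar> + int m * (B - A)}" by simp
    qed
  qed
  moreover have "card (X m) = card (T (r + m * D))" for m
    unfolding X_def by (rule card_image) (simp add: inj_on_def)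
  ultimately show "eventually_linear (\<lambda>m. int (card (T (r + m * D))))" by simp
qed

section \<open>Integer levels in place of hyperplanes\<close>

definition lattice_values :: "int ^ 'd \<Rightarrow> (real ^ 'd) set \<Rightarrow> int set" where
  "lattice_values c K = {t. \<exists>x\<in>K \<inter> integer_points. real_vec c \<bullet> x = of_int t}"

lemma real_vec_inner_integer_point:
  assumes "x \<in> integer_points"
  obtains t where "real_vec c \<bullet> x = of_int t"
proof -
  have "real_vec c \<bullet> x \<in> \<int>"
    using assms unfolding inner_vec_def real_vec_def integer_points_def
    by (auto intro!: Ints_sum Ints_mult)
  then show ?thesis using that by (auto elim: Ints_cases)
qed

lemma arithmetic_width_eq_card_lattice_values:
  "arithmetic_width c K = card (lattice_values c K)"
proof -
  let ?H = "\<lambda>t::int. {x. real_vec c \<bullet> x = of_int t}"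
  have "lattice_hyperplanes c K = ?H ` lattice_values c K"
  proof (intro equalityI subsetI)
    fix H assume "H \<in> lattice_hyperplanes c K"
    then obtain s x where H: "H = {x. real_vec c \<bullet> x = s}" and x: "x \<in> H" "x \<in> K \<inter> integer_points"
      unfolding lattice_hyperplanes_def by blast
    then obtain t where t: "real_vec c \<bullet> x = of_int t"
      using real_vec_inner_integer_point by blast
    then have "t \<in> lattice_values c K" using x unfolding lattice_values_def by blast
    moreover have "H = ?H t" using H x t by simp
    ultimately show "H \<in> ?H ` lattice_values c K" by blast
  qed (auto simp: lattice_hyperplanes_def lattice_values_def)
  \<comment> \<open>Each level in \<open>lattice_values c K\<close> is attained at a point, and a
    nonempty hyperplane determines its level.\<close>
  moreover have "inj_on ?H (lattice_values c K)"
    by (rule inj_onI) (auto simp: lattice_values_def set_eq_iff)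
  ultimately show ?thesis
    unfolding arithmetic_width_def by (simp add: card_image)
qed

section \<open>Lattice points in dilates of rational polytopes\<close>

lemma common_denominator_Rats:
  fixes S :: "real set"
  assumes "finite S" and "S \<subseteq> \<rat>"
  obtains D :: nat where "D > 0" and "\<forall>s\<in>S. real D * s \<in> \<int>"
proof -
  from assms have "\<exists>D::nat. D > 0 \<and> (\<forall>s\<in>S. real D * s \<in> \<int>)"
  proof (induction S rule: finite_induct)
    case empty
    then show ?case by (intro exI[of _ 1]) simp
  next
    case (insert s S)
    then obtain D where D: "D > 0" "\<forall>s\<in>S. real D * s \<in> \<int>" by auto
    from insert.prems obtain p q where s: "s = of_int p / of_int q" "q > 0"
      by (auto elim: Rats_cases')
    \<comment> \<open>The factor \<open>q\<close> clears the denominator of \<open>s\<close>; the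
      older elements only gain an integer factor.\<close>
    have "real (D * nat q) * s = of_int (int D * p)"
      using s by simp
    then have "real (D * nat q) * s \<in> \<int>" by (metis Ints_of_int)
    moreover have "real (D * nat q) * t \<in> \<int>" if "t \<in> S" for t
    proof -
      have "real (D * nat q) * t = (real D * t) * real (nat q)" by simp
      then show ?thesis using D that by (metis Ints_mult Ints_of_nat)
    qed
    ultimately show ?case using D s by (intro exI[of _ "D * nat q"]) auto
  qed
  then show ?thesis using that by blast
qed

text \<open>The sum is \<open>n + D\<close> times a weighted mean of two points of \<open>P\<close>;
  \<open>D > 0\<close> keeps the weights defined at \<open>n = 0\<close>.\<close>

lemma scaled_add_mem_convex:
  fixes P :: "'a::real_vector set"
  assumes "convex P" "x \<in> (\<lambda>y. real n *\<^sub>R y) ` P" "u \<in> P" "D > 0"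
  shows "x + real D *\<^sub>R u \<in> (\<lambda>y. real (n + D) *\<^sub>R y) ` P"
proof -
  obtain y where y: "y \<in> P" "x = real n *\<^sub>R y" using assms by blast
  let ?z = "(real n / real (n + D)) *\<^sub>R y + (real D / real (n + D)) *\<^sub>R u"
  have "real n / real (n + D) + real D / real (n + D) = 1"
    using assms(4) by (simp flip: add_divide_distrib)
  then have "?z \<in> P"
    using assms(1,3) y by (intro convexD) auto
  moreover have "x + real D *\<^sub>R u = real (n + D) *\<^sub>R ?z"
    using y assms by (simp add: scaleR_add_right)
  ultimately show ?thesis by blast
qed

text \<open>Translation by the lattice point \<open>D u\<close> carries lattice points of
  \<open>nP\<close> into \<open>(n + D)P\<close>. It is applied with \<open>u\<close> minimizing or
  maximizing \<open>c\<close> on \<open>P\<close>.\<close>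

lemma lattice_values_add:
  fixes P :: "(real ^ 'd) set"
  assumes "convex P" "u \<in> P" "D > 0" "real D *\<^sub>R u \<in> integer_points"
    and a: "real_vec c \<bullet> (real D *\<^sub>R u) = of_int a"
    and "t \<in> lattice_values c ((\<lambda>x. real n *\<^sub>R x) ` P)"
  shows "t + a \<in> lattice_values c ((\<lambda>x. real (n + D) *\<^sub>R x) ` P)"
proof -
  from assms obtain x where x: "x \<in> (\<lambda>x. real n *\<^sub>R x) ` P" "x \<in> integer_points"
    "real_vec c \<bullet> x = of_int t"
    unfolding lattice_values_def by blast
  have "x + real D *\<^sub>R u \<in> (\<lambda>x. real (n + D) *\<^sub>R x) ` P"
    by (rule scaled_add_mem_convex) (use assms x in auto)
  moreover have "x + real D *\<^sub>R u \<in> integer_points"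
    using x assms(4) by (auto simp: integer_points_def)
  moreover have "real_vec c \<bullet> (x + real D *\<^sub>R u) = of_int (t + a)"
    using x a by (simp only: inner_add_right of_int_add)
  ultimately show ?thesis unfolding lattice_values_def by blast
qed

theorem theorem4p2:
  fixes P :: "(real ^ 'd) set" and c :: "int ^ 'd"
  assumes "rational_polytope P" and "c \<noteq> 0"
  shows "eventually_quasilinear (\<lambda>n. int (arithmetic_width c ((\<lambda>x. real n *\<^sub>R x) ` P)))"
proof -
  from assms(1) obtain V where V: "finite V" "\<And>v i. v \<in> V \<Longrightarrow> v $ i \<in> \<rat>"
    and P: "P = convex hull V"
    unfolding rational_polytope_def by blast
  define T where "T n = lattice_values c ((\<lambda>x. real n *\<^sub>R x) ` P)" for n
  have "eventually_quasilinear (\<lambda>n. int (card (T n)))"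
  proof (cases "V = {}")
    case True
    then have "T n = {}" for n by (simp add: T_def P lattice_values_def)
    then show ?thesis
      by (intro eventually_quasilinear_card[of 1 0 0]) auto
  next
    case False
    let ?S = "\<Union>v\<in>V. range (($) v)"
    have "finite ?S" "?S \<subseteq> \<rat>"
      using V by auto
    then obtain D :: nat where D: "D > 0" and denom: "\<forall>s\<in>?S. real D * s \<in> \<int>"
      by (rule common_denominator_Rats)
    have int: "real D *\<^sub>R v \<in> integer_points" if "v \<in> V" for v
      unfolding integer_points_def using denom that by auto
    let ?c = "\<lambda>x. real_vec c \<bullet> x"
    obtain u where u: "u \<in> V" "\<And>v. v \<in> V \<Longrightarrow> ?c u \<le> ?c v"
      using False V(1) arg_min_if_finite[of V ?c] by (metis not_le)
    obtain w where w: "w \<in> V" "\<And>v. v \<in> V \<Longrightarrow> ?c v \<le> ?c w"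
      using False V(1) arg_min_if_finite[of V "\<lambda>x. - ?c x"] by (metis neg_less_iff_less not_le)
    obtain A where A: "?c (real D *\<^sub>R u) = of_int A"
      using real_vec_inner_integer_point int u by blast
    obtain B where B: "?c (real D *\<^sub>R w) = of_int B"
      using real_vec_inner_integer_point int w by blast
    have lower: "?c u \<le> ?c y" and upper: "?c y \<le> ?c w" if "y \<in> P" for y
    proof -
      \<comment> \<open>Half-spaces are convex, so bounds that hold on \<open>V\<close> extend to
        its hull.\<close>
      have "P \<subseteq> {x. ?c x \<ge> ?c u}" "P \<subseteq> {x. ?c x \<le> ?c w}"
        unfolding P using u w
        by (intro hull_minimal convex_halfspace_ge convex_halfspace_le; blast)+
      then show "?c u \<le> ?c y" "?c y \<le> ?c w" using that by auto
    qed
    have conv: "convex P" and uP: "u \<in> P" and wP: "w \<in> P"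
      using u w by (auto simp: P hull_inc)
    show ?thesis
    proof (rule eventually_quasilinear_card[OF D])
      have "real D * ?c u \<le> real D * ?c w" using u w by (intro mult_left_mono) auto
      then show "A \<le> B" using A B by simp
      fix n t assume t: "t \<in> T n"
      then obtain y where y: "y \<in> P" "real n * ?c y = of_int t"
        unfolding T_def lattice_values_def by auto
      \<comment> \<open>Multiplying the bound at \<open>y\<close> by \<open>n * D\<close> avoids
        dividing by \<open>n\<close>, which may be 0.\<close>
      have "real n * (real D * ?c u) \<le> real D * (real n * ?c y)"
        using mult_left_mono[OF lower[OF y(1)], of "real n * real D"] by (simp add: mult_ac)
      then have "real_of_int (int n * A) \<le> real_of_int (int D * t)"
        using A y by simp
      then show "int n * A \<le> int D * t" by (simp only: of_int_le_iff)
      have "real D * (real n * ?c y) \<le> real n * (real D * ?c w)"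
        using mult_left_mono[OF upper[OF y(1)], of "real n * real D"] by (simp add: mult_ac)
      then have "real_of_int (int D * t) \<le> real_of_int (int n * B)"
        using B y by simp
      then show "int D * t \<le> int n * B" by (simp only: of_int_le_iff)
      show "t + A \<in> T (n + D)"
        using lattice_values_add[OF conv uP D int[OF u(1)] A] t unfolding T_def by blast
      show "t + B \<in> T (n + D)"
        using lattice_values_add[OF conv wP D int[OF w(1)] B] t unfolding T_def by blast
    qed
  qed
  then show ?thesis by (simp add: T_def arithmetic_width_eq_card_lattice_values)
qed

end
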